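(* In Algorithm 1 or Algorithm 2 (described in the context), let $\omega$ be the length of the interval $\tau_i^k[l]$, let $\alpha_k=D_i^{-1}$ for Algorithm 1 and $\alpha_k=\eta_k$ for Algorithm 2, and let $$\gamma_l^k=\mathbb E_{x_i^k}\left[\frac{\epsilon_l^k(X)}{\alpha_k\beta_k\mathscr B_\infty}\ \Big|\ x^{[0:k-1]}_{[1:N]}\right].$$ When $\omega>\alpha_k\mathscr B_\infty$, $$\gamma_l^k\le\frac{1}{\alpha_k\beta_k\mathscr B_\infty}\log\left\{e^{\alpha_k\beta_k\mathscr B_\infty}\left[1-2\int_0^{\frac{\omega-\alpha_k\mathscr B_\infty}{2}}\int_0^{\omega}\Phi(x,y)\,dy\,dx\right]+2\int_0^{\frac{\omega-\alpha_k\mathscr B_\infty}{2}}\int_{-\alpha_k\mathscr B_\infty}^{\omega-\alpha_k\mathscr B_\infty}\Phi(x,y)\,dy\,dx\right\},$$ where $\Phi(x,y)=\frac{\beta_k}{2\omega}e^{-\beta_k|x-y|}$.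
   Context: Setting: $N$ agents on a complete graph solve a consensus problem; agent $i$ holds a private differentiable convex function $f_i:\mathcal C\to\mathbb R$, $\mathcal C\subset\mathbb R^d$ closed and convex (any projection step onto $\mathcal C$ is omitted). $x[l]$ is the $l$-th coordinate of $x\in\mathbb R^d$, $[a:b]=\{a,\dots,b\}$, and $X=x^{[0:K]}_{[1:N]}$ is the collection of all iterates $x_i^k$. Sensitivity: $\mathscr F_i$ is a set of functions such that $\mathscr B_\infty\ge\sup_{x\in\mathcal C}\|\nabla f_i(x)-\nabla\hat f_i(x)\|_\infty$ for any $f_i,\hat f_i\in\mathscr F_i$. Algorithm 1 (private ADMM with first-order approximation): $x^0_{[1:N]}$ is initialized randomly, $\lambda_i^0=0$; each agent selects a private constant $D_i$; $\zeta$ is a step penalty. For $k=0,\dots,K-1$ each agent $i$ randomly picks positive diagonal matrices $\bar\rho_i^{k+1},\Gamma_i^{k+1}$ with $(N-1)\bar\rho_i^{k+1}+\Gamma_i^{k+1}=D_iI_d$ and sets $$x_i^{k+1}=\underbrace{\tfrac{\Gamma_i^{k+1}}{D_i}x_i^k+\tfrac{(N-1)\bar\rho_i^{k+1}}{D_i}\tfrac{\sum_{j\ne i}x_j^k}{N-1}}_{A}-D_i^{-1}\nabla f_i(x_i^k)+D_i^{-1}\lambda_i^k+\Delta_i^{k+1};$$ the $x_i^{k+1}$ are exchanged and $\lambda_i^{k+1}=\lambda_i^k-\zeta\sum_{j\ne i}(x_j^{k+1}-x_i^{k+1})$. Algorithm 2 (private decentralized gradient descent): given a diminishing sequence $\eta_k$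 and initial $x^0_{[1:N]}$, for $k=0,\dots,K-1$ each agent $i$ randomly picks a positive diagonal matrix $w_i^{k+1}$ with diagonal entries in $(0,1)$ and sets $$x_i^{k+1}=\underbrace{\tfrac{2w_i^{k+1}}{N}x^k_{i_k}+\tfrac{2(I_d-w_i^{k+1})}{N}x^k_{\hat i_k}+\tfrac1N\sum_{j\ne i_k,\hat i_k}x_j^k}_{A}-\eta_{k+1}\nabla f_i\Big(\tfrac1N\sum_{j=1}^Nx_j^k\Big)+\Delta_i^{k+1},$$ where $(i_k,\hat i_k)=\arg\max_{(j_1,j_2)}\|x^k_{j_1}-x^k_{j_2}\|_1$; the $x_i^{k+1}$ are exchanged. Randomness: the coordinates of $\Delta_i^k$ are i.i.d. Laplace with density $P(y)=\frac{\beta_k}{2}e^{-\beta_k|y|}$. The random weights are selected so that each coordinate of the term $A$ is uniformly distributed on the interval it ranges over. Thus, conditionally on $f_i$ and $x^{[0:k-1]}_{[1:N]}$, $x_i^k[l]$ follows a Laplace distribution with parameter $\beta_k$ whose mean is uniformly distributed in an interval denoted $\tau_i^k[l]$: the range of the $l$-th coordinate of $A$ (formed at step $k$ from the iterates of step $k-1$), shifted by the $l$-th coordinate of $-D_i^{-1}\nabla f_i(x_i^{k-1})+D_i^{-1}\lambda_i^{k-1}$ in Algorithm 1, or of $-\eta_k\nabla f_i(\frac1N\sum_jx_j^{k-1})$ in Algorithm 2. Privacy loss at iteration $k$ and coordinate $l$ ($P(\cdot\mid\cdot)$ is conditional density): $$\epsilon_l^{k}(X)=\sup_{f_i,\hat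 f_i\in\mathscr F_i}\left|\log\frac{P(x_i^{k}[l]\mid f_i,x^{[0:k-1]}_{[1:N]})}{P(x_i^{k}[l]\mid\hat f_i,x^{[0:k-1]}_{[1:N]})}\right|.$$ *)

theory Defs
  imports "HOL-Probability.Probability"
begin

text \<open>
  Agents are the elements of a finite type \<^typ>\<open>'n\<close>, so that \<open>N = CARD('n)\<close>; a trajectory
  assigns to each iteration \<open>m\<close> and agent \<open>j\<close> the iterate \<open>X m j\<close>.
\<close>

type_synonym ('n, 'd) trajectory = "nat \<Rightarrow> 'n \<Rightarrow> real^'d"

text \<open>
  The derivative is taken within \<open>C\<close>, so the gradient depends only on the restriction of \<open>f\<close>
  to \<open>C\<close>. It is unique as soon as the convex set \<open>C\<close> has nonempty interior.
\<close>

definition gradient :: "(real^'d) set \<Rightarrow> (real^'d \<Rightarrow> real) \<Rightarrow> real^'d \<Rightarrow> real^'d" where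
  "gradient C f x = (SOME g. (f has_derivative (\<lambda>h. g \<bullet> h)) (at x within C))"

definition sensitivity_bound :: "(real^'d) set \<Rightarrow> (real^'d \<Rightarrow> real) set \<Rightarrow> real \<Rightarrow> bool" where
  "sensitivity_bound C F B \<longleftrightarrow>
     (\<forall>f\<in>F. \<forall>g\<in>F. \<forall>x\<in>C. infnorm (gradient C f x - gradient C g x) \<le> B)"

definition diagonal_mat :: "real^'d^'d \<Rightarrow> bool" where
  "diagonal_mat W \<longleftrightarrow> (\<forall>i j. i \<noteq> j \<longrightarrow> W $ i $ j = 0)"

definition norm1 :: "real^'d \<Rightarrow> real" where
  "norm1 v = (\<Sum>l\<in>UNIV. \<bar>v $ l\<bar>)"


section \<open>Noise and random weights\<close>

definition laplace :: "real \<Rightarrow> real measure" where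
  "laplace b = density lborel (\<lambda>y. ennreal (b / 2 * exp (- b * \<bar>y\<bar>)))"

definition laplace_vec :: "real \<Rightarrow> (real^'d) measure" where
  "laplace_vec b = distr (Pi\<^sub>M (UNIV :: 'd set) (\<lambda>_. laplace b)) borel (\<lambda>g. \<chi> l. g l)"

text \<open>The range of a coordinate is a single point when the averaged iterates agree there.\<close>

definition uniform_on :: "real set \<Rightarrow> real measure" where
  "uniform_on S = (if is_singleton S then return borel (the_elem S) else uniform_measure lborel S)"

text \<open>
  \<open>W\<close> is the set of admissible weights and \<open>A w\<close> the weighted average formed with the weight
  \<open>w\<close>. No assumption is made on the joint law of the coordinates.
\<close>

definition random_weights ::
  "'w::topological_space set \<Rightarrow> ('w \<Rightarrow> real^'d) \<Rightarrow> 'w measure \<Rightarrow> bool" where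
  "random_weights W A Q \<longleftrightarrow>
     prob_space Q \<and> sets Q = sets borel \<and> (AE w in Q. w \<in> W) \<and>
     (\<forall>l. distr Q borel (\<lambda>w. A w $ l) = uniform_on ((\<lambda>w. A w $ l) ` W))"

text \<open>
  Law of \<open>A w + c + \<delta>\<close>, with the weight \<open>w\<close> drawn from \<open>Q\<close> and independent Laplace noise \<open>\<delta>\<close>,
  and the range of the mean \<open>A w + c\<close> in coordinate \<open>l\<close>.
\<close>

definition step_law ::
  "'w measure \<Rightarrow> ('w \<Rightarrow> real^'d) \<Rightarrow> real^'d \<Rightarrow> real \<Rightarrow> (real^'d) measure" where
  "step_law Q A c b = distr (Q \<Otimes>\<^sub>M laplace_vec b) borel (\<lambda>(w, \<delta>). A w + c + \<delta>)"

definition mean_range :: "'w set \<Rightarrow> ('w \<Rightarrow> real^'d) \<Rightarrow> real^'d \<Rightarrow> 'd \<Rightarrow> real set" where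
  "mean_range W A c l = (\<lambda>w. A w $ l + c $ l) ` W"


section \<open>Private ADMM with first-order approximation\<close>

text \<open>A weight is the pair of matrices written \<open>(\<rho>, \<Gamma>)\<close> below.\<close>

definition admm_weights :: "'n::finite itself \<Rightarrow> real \<Rightarrow> ((real^'d^'d) \<times> (real^'d^'d)) set" where
  "admm_weights _ D = {(\<rho>, \<Gamma>).
     diagonal_mat \<rho> \<and> (\<forall>l. 0 < \<rho> $ l $ l) \<and> diagonal_mat \<Gamma> \<and> (\<forall>l. 0 < \<Gamma> $ l $ l) \<and>
     (real CARD('n) - 1) *\<^sub>R \<rho> + \<Gamma> = D *\<^sub>R mat 1}"

definition admm_average ::
  "real \<Rightarrow> 'n::finite \<Rightarrow> ('n \<Rightarrow> real^'d) \<Rightarrow> (real^'d^'d) \<times> (real^'d^'d) \<Rightarrow> real^'d" where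
  "admm_average D i x = (\<lambda>(\<rho>, \<Gamma>).
     ((1 / D) *\<^sub>R \<Gamma>) *v x i +
     (((real CARD('n) - 1) / D) *\<^sub>R \<rho>) *v
       ((1 / (real CARD('n) - 1)) *\<^sub>R (\<Sum>j\<in>UNIV - {i}. x j)))"

primrec admm_dual :: "real \<Rightarrow> 'n::finite \<Rightarrow> ('n, 'd) trajectory \<Rightarrow> nat \<Rightarrow> real^'d" where
  "admm_dual \<zeta> i X 0 = 0"
| "admm_dual \<zeta> i X (Suc m) =
     admm_dual \<zeta> i X m - \<zeta> *\<^sub>R (\<Sum>j\<in>UNIV - {i}. X (Suc m) j - X (Suc m) i)"

definition admm_shift ::
  "(real^'d) set \<Rightarrow> real \<Rightarrow> real \<Rightarrow> 'n::finite \<Rightarrow> (real^'d \<Rightarrow> real) \<Rightarrow> ('n, 'd) trajectory \<Rightarrow> nat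
     \<Rightarrow> real^'d" where
  "admm_shift C D \<zeta> i f X m =
     - ((1 / D) *\<^sub>R gradient C f (X m i)) + (1 / D) *\<^sub>R admm_dual \<zeta> i X m"

text \<open>
  The conditional law of the iterate \<open>X k i\<close> (\<open>k \<ge> 1\<close>) when agent \<open>i\<close> holds \<open>f\<close> and the past
  iterates are \<open>X 0, \<dots>, X (k - 1)\<close>; \<open>Q\<close> is the law of the weights given that past. Conditional
  laws are rendered as transition kernels, hence are defined at every history rather than up to
  null sets of histories.
\<close>

definition admm_law ::
  "(real^'d) set \<Rightarrow> real \<Rightarrow> real \<Rightarrow> (nat \<Rightarrow> real) \<Rightarrow> ((real^'d^'d) \<times> (real^'d^'d)) measure \<Rightarrow> nat \<Rightarrow>
     'n::finite \<Rightarrow> (real^'d \<Rightarrow> real) \<Rightarrow> ('n, 'd) trajectory \<Rightarrow> (real^'d) measure" where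
  "admm_law C D \<zeta> \<beta> Q k i f X =
     step_law Q (admm_average D i (X (k - 1))) (admm_shift C D \<zeta> i f X (k - 1)) (\<beta> k)"

definition admm_tau ::
  "(real^'d) set \<Rightarrow> real \<Rightarrow> real \<Rightarrow> nat \<Rightarrow> 'n::finite \<Rightarrow> (real^'d \<Rightarrow> real) \<Rightarrow> ('n, 'd) trajectory \<Rightarrow>
     'd \<Rightarrow> real set" where
  "admm_tau C D \<zeta> k i f X l =
     mean_range (admm_weights TYPE('n) D) (admm_average D i (X (k - 1)))
       (admm_shift C D \<zeta> i f X (k - 1)) l"


section \<open>Private decentralized gradient descent\<close>

text \<open>A pair of distinct agents at maximal distance; ties may be broken in any way.\<close>

definition farthest_pair :: "('n \<Rightarrow> real^'d) \<Rightarrow> 'n \<times> 'n \<Rightarrow> bool" where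
  "farthest_pair x = is_arg_max (\<lambda>(a, b). norm1 (x a - x b)) (\<lambda>(a, b). a \<noteq> b)"

definition dgd_weights :: "(real^'d^'d) set" where
  "dgd_weights = {w. diagonal_mat w \<and> (\<forall>l. 0 < w $ l $ l \<and> w $ l $ l < 1)}"

definition dgd_average :: "'n::finite \<times> 'n \<Rightarrow> ('n \<Rightarrow> real^'d) \<Rightarrow> real^'d^'d \<Rightarrow> real^'d" where
  "dgd_average pq x w = (case pq of (p, q) \<Rightarrow>
     ((2 / real CARD('n)) *\<^sub>R w) *v x p +
     ((2 / real CARD('n)) *\<^sub>R (mat 1 - w)) *v x q +
     (1 / real CARD('n)) *\<^sub>R (\<Sum>j\<in>UNIV - {p, q}. x j))"

definition dgd_shift ::
  "(real^'d) set \<Rightarrow> real \<Rightarrow> (real^'d \<Rightarrow> real) \<Rightarrow> ('n::finite \<Rightarrow> real^'d) \<Rightarrow> real^'d" where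
  "dgd_shift C a f x = - (a *\<^sub>R gradient C f ((1 / real CARD('n)) *\<^sub>R (\<Sum>j\<in>UNIV. x j)))"

definition dgd_law ::
  "(real^'d) set \<Rightarrow> (nat \<Rightarrow> real) \<Rightarrow> (nat \<Rightarrow> real) \<Rightarrow> 'n::finite \<times> 'n \<Rightarrow> (real^'d^'d) measure \<Rightarrow>
     nat \<Rightarrow> (real^'d \<Rightarrow> real) \<Rightarrow> ('n, 'd) trajectory \<Rightarrow> (real^'d) measure" where
  "dgd_law C \<eta> \<beta> pq Q k f X =
     step_law Q (dgd_average pq (X (k - 1))) (dgd_shift C (\<eta> k) f (X (k - 1))) (\<beta> k)"

definition dgd_tau ::
  "(real^'d) set \<Rightarrow> (nat \<Rightarrow> real) \<Rightarrow> 'n::finite \<times> 'n \<Rightarrow> nat \<Rightarrow> (real^'d \<Rightarrow> real) \<Rightarrow>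
     ('n, 'd) trajectory \<Rightarrow> 'd \<Rightarrow> real set" where
  "dgd_tau C \<eta> pq k f X l =
     mean_range dgd_weights (dgd_average pq (X (k - 1))) (dgd_shift C (\<eta> k) f (X (k - 1))) l"


section \<open>Privacy loss\<close>

text \<open>
  The privacy loss is a pointwise supremum over a possibly uncountable family, so the version of
  the density matters: it is the continuous one.
\<close>

definition coord_density :: "(real^'d) measure \<Rightarrow> 'd \<Rightarrow> real \<Rightarrow> real" where
  "coord_density L l = (THE p. continuous_on UNIV p \<and> (\<forall>z. 0 \<le> p z) \<and>
     distributed L lborel (\<lambda>v. v $ l) (\<lambda>z. ennreal (p z)))"

text \<open>
  \<open>Law f X\<close> is the conditional law of \<open>X k i\<close> given \<open>f\<close> and the iterates of \<open>X\<close> before \<open>k\<close>.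
\<close>

definition privacy_loss ::
  "(real^'d \<Rightarrow> real) set \<Rightarrow> ((real^'d \<Rightarrow> real) \<Rightarrow> ('n, 'd) trajectory \<Rightarrow> (real^'d) measure) \<Rightarrow>
     nat \<Rightarrow> 'n \<Rightarrow> 'd \<Rightarrow> ('n, 'd) trajectory \<Rightarrow> real" where
  "privacy_loss F Law k i l X =
     (SUP (f, g) \<in> F \<times> F.
        \<bar>ln (coord_density (Law f X) l (X k i $ l) / coord_density (Law g X) l (X k i $ l))\<bar>)"

text \<open>
  The expectation is over the iterate \<open>X k i\<close>, replaced by \<open>z\<close>, when agent \<open>i\<close> holds \<open>f\<close>.
\<close>

definition expected_loss ::
  "(real^'d \<Rightarrow> real) set \<Rightarrow> ((real^'d \<Rightarrow> real) \<Rightarrow> ('n, 'd) trajectory \<Rightarrow> (real^'d) measure) \<Rightarrow>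
     real \<Rightarrow> real \<Rightarrow> real \<Rightarrow> nat \<Rightarrow> 'n \<Rightarrow> 'd \<Rightarrow> (real^'d \<Rightarrow> real) \<Rightarrow> ('n, 'd) trajectory \<Rightarrow> real" where
  "expected_loss F Law a b B k i l f X =
     (\<integral>z. privacy_loss F Law k i l (X(k := (X k)(i := z))) / (a * b * B) \<partial>Law f X)"

definition Phi :: "real \<Rightarrow> real \<Rightarrow> real \<Rightarrow> real \<Rightarrow> real" where
  "Phi b \<omega> x y = b / (2 * \<omega>) * exp (- b * \<bar>x - y\<bar>)"

definition loss_bound :: "real \<Rightarrow> real \<Rightarrow> real \<Rightarrow> real \<Rightarrow> real" where
  "loss_bound a b B \<omega> =
     1 / (a * b * B) *
     ln (exp (a * b * B) *
           (1 - 2 * integral {0..(\<omega> - a * B) / 2} (\<lambda>x. integral {0..\<omega>} (Phi b \<omega> x))) +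
         2 * integral {0..(\<omega> - a * B) / 2}
               (\<lambda>x. integral {- (a * B)..\<omega> - a * B} (Phi b \<omega> x)))"

end

theory Submission
  imports Defs
begin

text \<open>
  Put \<open>c = a * B\<close>. Each coordinate of the new iterate has density \<open>u \<bar>y - \<nu>\<bar>\<close>, where \<open>u\<close> is decreasing
  with \<open>u d \<le> exp (b * (e - d)) * u e\<close> for \<open>d \<le> e\<close>, and the centres \<open>\<nu>\<close> belonging to the various
  private functions lie within \<open>c / 2\<close> of a common \<open>\<mu>\<close>. The loss at \<open>y\<close> is therefore at most
  \<open>ln (G y)\<close>, where \<open>G\<close> is the quotient of the largest and the smallest value of \<open>u\<close> over all
  admissible centres. By concavity of \<open>ln\<close> it suffices to bound the mean of \<open>G\<close>. The density is at least
  the smallest admissible value of \<open>u\<close>, so \<open>exp (b * c)\<close> minus this mean is at least the integral of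
  \<open>h d = exp (b * c) * u (d + c / 2) - u (max 0 (d - c / 2))\<close> with \<open>d = \<bar>y - \<mu>\<bar>\<close>. Compared with the
  claimed bound, \<open>h\<close> loses near \<open>d = 0\<close>, where the supremum over both functions can reach the
  mode of the density, but it gains more for \<open>d\<close> between \<open>(w - c) / 2\<close> and \<open>(w + c) / 2\<close>: the gain and
  the loss are both explicit integrals of \<open>cosh - 1\<close>.
\<close>

section \<open>Convolution of uniform and Laplace densities\<close>

text \<open>
  The density of the sum of a uniform variable on an interval of length \<open>w\<close> and a Laplace variable
  of parameter \<open>b\<close>, at distance \<open>d\<close> from the midpoint of the interval.
\<close>

definition unif_laplace :: "real \<Rightarrow> real \<Rightarrow> real \<Rightarrow> real" where
  "unif_laplace b w d =
     (if d \<le> w / 2 then 1 - exp (- (b * w / 2)) * cosh (b * d)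
      else exp (- (b * d)) * sinh (b * w / 2)) / w"

text \<open>The two branches agree at \<open>d = w / 2\<close>, because
  \<open>exp (- t) * (cosh t + sinh t) = 1\<close> with \<open>t = b * w / 2\<close>. The tail
  formula thus includes the boundary point, where the pieces are glued later.\<close>

lemma unif_laplace_outer:
  assumes "w / 2 \<le> d"
  shows "unif_laplace b w d = exp (- (b * d)) * sinh (b * w / 2) / w"
proof (cases "d = w / 2")
  case True
  have "1 - exp (- (b * w / 2)) * cosh (b * w / 2) = exp (- (b * w / 2)) * sinh (b * w / 2)"
    by (simp add: cosh_def sinh_def field_simps flip: exp_add)
  with True show ?thesis
    unfolding True by (simp add: unif_laplace_def)
qed (use assms in \<open>simp add: unif_laplace_def\<close>)

lemma Phi_has_integral_right:
  assumes "b > 0" "w > 0" "t \<le> p" "p \<le> q"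
  shows "(Phi b w t has_integral (exp (- b * (p - t)) - exp (- b * (q - t))) / (2 * w)) {p..q}"
proof -
  have "((\<lambda>y. b / (2 * w) * exp (- b * (y - t))) has_integral
      (- exp (- b * (q - t)) / (2 * w)) - (- exp (- b * (p - t)) / (2 * w))) {p..q}"
    using assms
    by (intro fundamental_theorem_of_calculus)
      (auto intro!: derivative_eq_intros simp flip: has_real_derivative_iff_has_vector_derivative)
  moreover have "b / (2 * w) * exp (- b * (y - t)) = Phi b w t y" if "y \<in> {p..q}" for y
    using that assms by (auto simp: Phi_def abs_if)
  ultimately show ?thesis
    by (subst has_integral_cong[where g = "\<lambda>y. b / (2 * w) * exp (- b * (y - t))"])
      (auto simp: diff_divide_distrib)
qed

lemma Phi_has_integral_left:
  assumes "b > 0" "w > 0" "q \<le> t" "p \<le> q"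
  shows "(Phi b w t has_integral (exp (- b * (t - q)) - exp (- b * (t - p))) / (2 * w)) {p..q}"
proof -
  have "((\<lambda>y. b / (2 * w) * exp (- b * (t - y))) has_integral
      (exp (- b * (t - q)) / (2 * w)) - (exp (- b * (t - p)) / (2 * w))) {p..q}"
    using assms
    by (intro fundamental_theorem_of_calculus)
      (auto intro!: derivative_eq_intros simp flip: has_real_derivative_iff_has_vector_derivative)
  moreover have "b / (2 * w) * exp (- b * (t - y)) = Phi b w t y" if "y \<in> {p..q}" for y
    using that assms by (auto simp: Phi_def abs_if)
  ultimately show ?thesis
    by (subst has_integral_cong[where g = "\<lambda>y. b / (2 * w) * exp (- b * (t - y))"])
      (auto simp: diff_divide_distrib)
qed

text \<open>Ties the closed form to the inner integrals of \<open>loss_bound\<close>. The kernel has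
  a kink at \<open>y = t\<close>: a centre \<open>t\<close> inside the interval cuts it in two, a
  centre outside leaves a single exponential.\<close>

lemma Phi_has_integral:
  assumes "b > 0" "w > 0"
  shows "(Phi b w t has_integral unif_laplace b w \<bar>t - w / 2\<bar>) {0..w}"
proof -
  consider "t \<le> 0" | "0 \<le> t" "t \<le> w" | "w \<le> t" by linarith
  then show ?thesis
  proof cases
    case 1
    have "(exp (- b * (0 - t)) - exp (- b * (w - t))) / (2 * w) = unif_laplace b w \<bar>t - w / 2\<bar>"
      using 1 assms
      by (simp add: unif_laplace_outer sinh_def field_simps flip: exp_add exp_diff)
    then show ?thesis
      using Phi_has_integral_right[of b w t 0 w] 1 assms by simp
  next
    case 2
    have "(exp (- b * (t - t)) - exp (- b * (t - 0))) / (2 * w) +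
        (exp (- b * (t - t)) - exp (- b * (w - t))) / (2 * w)
        = (1 - exp (- (b * w / 2)) * cosh (b * (t - w / 2))) / w"
      using 2 assms
      by (simp add: cosh_def field_simps flip: exp_add exp_diff)
    also have "\<dots> = unif_laplace b w \<bar>t - w / 2\<bar>"
    proof -
      have "cosh (b * \<bar>t - w / 2\<bar>) = cosh (b * (t - w / 2))"
        by (metis abs_mult_pos' assms(1) cosh_real_abs less_imp_le)
      moreover have "\<bar>t - w / 2\<bar> \<le> w / 2" using 2 by linarith
      ultimately show ?thesis by (simp add: unif_laplace_def)
    qed
    finally show ?thesis
      using has_integral_combine[OF 2
          Phi_has_integral_left[of b w t t 0] Phi_has_integral_right[of b w t t w]] 2 assms by simp
  next
    case 3
    have "(exp (- b * (t - w)) - exp (- b * (t - 0))) / (2 * w) = unif_laplace b w \<bar>t - w / 2\<bar>"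
      using 3 assms
      by (simp add: unif_laplace_outer sinh_def field_simps flip: exp_add exp_diff)
    then show ?thesis
      using Phi_has_integral_left[of b w w t 0] 3 assms by simp
  qed
qed

section \<open>Continuity, monotonicity and decay rate of the density\<close>

lemma continuous_on_unif_laplace [continuous_intros]:
  assumes "w > 0" "continuous_on S f"
  shows "continuous_on S (\<lambda>x. unif_laplace b w (f x))"
proof -
  have "continuous_on UNIV (\<lambda>d. if d \<le> w / 2 then (1 - exp (- (b * w / 2)) * cosh (b * d)) / w
      else exp (- (b * d)) * sinh (b * w / 2) / w)"
    using unif_laplace_outer[of w "w / 2" b]
    by (intro continuous_on_cases_le continuous_intros) (use assms(1) in \<open>auto simp: unif_laplace_def\<close>)
  then have "continuous_on UNIV (unif_laplace b w)"
    by (auto simp: unif_laplace_def[abs_def] if_distrib[of "\<lambda>x. x / w"] cong: if_cong)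
  then show ?thesis
    using continuous_on_compose2[OF _ assms(2)] by auto
qed

text \<open>Up to \<open>w / 2\<close> this is the growth of \<open>cosh\<close>, beyond it the
  decay of the exponential; the two are chained at \<open>w / 2\<close>.\<close>

lemma unif_laplace_antimono:
  assumes "b > 0" "w > 0" "0 \<le> d" "d \<le> e"
  shows "unif_laplace b w e \<le> unif_laplace b w d"
proof -
  have inner: "unif_laplace b w y \<le> unif_laplace b w x" if "0 \<le> x" "x \<le> y" "y \<le> w / 2" for x y
    using that assms cosh_real_nonneg_le_iff[of "b * x" "b * y"]
    by (auto simp: unif_laplace_def intro!: divide_right_mono)
  have outer: "unif_laplace b w y \<le> unif_laplace b w x" if "w / 2 \<le> x" "x \<le> y" for x y
    using that assms
    by (auto simp: unif_laplace_outer intro!: divide_right_mono mult_right_mono)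
  show ?thesis
    using inner[of d e] outer[of d e] inner[of d "w / 2"] outer[of "w / 2" e] assms by linarith
qed

text \<open>The sign is evident in the tail formula, and monotonicity carries it inwards.\<close>

lemma unif_laplace_pos:
  assumes "b > 0" "w > 0" "0 \<le> d"
  shows "unif_laplace b w d > 0"
proof -
  have "0 < unif_laplace b w (max d (w / 2))"
    using assms by (simp add: unif_laplace_outer)
  also have "\<dots> \<le> unif_laplace b w d"
    using assms by (intro unif_laplace_antimono) auto
  finally show ?thesis .
qed

text \<open>By the triangle inequality, moving the centre of a Laplace kernel by
  \<open>e - d\<close> changes it pointwise by a factor of at most \<open>exp (b * (e - d))\<close>.
  Averaging over the uniform variable preserves this.\<close>

lemma unif_laplace_ratio:
  assumes "b > 0" "w > 0" "0 \<le> d" "d \<le> e"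
  shows "unif_laplace b w d \<le> exp (b * (e - d)) * unif_laplace b w e"
proof -
  have I: "(Phi b w (w / 2 + x) has_integral unif_laplace b w x) {0..w}" if "0 \<le> x" for x
    using Phi_has_integral[of b w "w / 2 + x"] that assms by simp
  have *: "Phi b w (w / 2 + d) y \<le> exp (b * (e - d)) * Phi b w (w / 2 + e) y" for y
  proof -
    have "b * \<bar>w / 2 + e - y\<bar> \<le> b * \<bar>w / 2 + d - y\<bar> + b * (e - d)"
      using assms by (simp flip: distrib_left)
    then have "exp (- b * \<bar>w / 2 + d - y\<bar>) \<le> exp (b * (e - d)) * exp (- b * \<bar>w / 2 + e - y\<bar>)"
      by (simp flip: exp_add)
    then show ?thesis
      using assms by (simp add: Phi_def divide_right_mono field_simps)
  qed
  show ?thesis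
    by (rule has_integral_le[OF I has_integral_mult_right[OF I]]) (use assms * in auto)
qed

section \<open>Integrals under reflection\<close>

lemma integral_reflect_interval:
  fixes g :: "real \<Rightarrow> real"
  assumes "continuous_on {0..s} g"
  shows "integral {0..s} (\<lambda>x. g (s - x)) = integral {0..s} g"
proof -
  have "(g has_integral integral {0..s} g) {0..s}"
    using assms integrable_continuous_interval by blast
  from has_integral_affinity[OF this[folded cbox_interval], of "-1" s]
  have "((\<lambda>x. g (s - x)) has_integral integral {0..s} g) ((\<lambda>x. s - x) ` {0..s})"
    by (simp add: image_image)
  moreover have "(\<lambda>x. s - x) ` {0..s} = {0..s}"
    by (auto simp: image_iff intro: bexI[of _ "s - x" for x])
  ultimately show ?thesis by (simp add: integral_unique)
qed

lemma integral_even: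
  fixes g :: "real \<Rightarrow> real"
  assumes "continuous_on {0..s} g" "0 \<le> s"
  shows "((\<lambda>x. g \<bar>x\<bar>) has_integral 2 * integral {0..s} g) {- s..s}"
proof -
  have I: "(g has_integral integral {0..s} g) {0..s}"
    using assms integrable_continuous_interval by blast
  then have "((\<lambda>x. g (- x)) has_integral integral {0..s} g) {- s..- 0}"
    by (subst has_integral_reflect_real)
  then have "((\<lambda>x. g \<bar>x\<bar>) has_integral integral {0..s} g) {- s..0}"
    by (subst has_integral_cong[where g = "\<lambda>x. g (- x)"]) auto
  moreover have "((\<lambda>x. g \<bar>x\<bar>) has_integral integral {0..s} g) {0..s}"
    using I by (subst has_integral_cong[where g = g]) auto
  ultimately show ?thesis
    using has_integral_combine[of "- s" 0 s "\<lambda>x. g \<bar>x\<bar>"] assms(2) by fastforce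
qed

section \<open>The expected likelihood ratio\<close>

text \<open>Loss near the centre against gain near the edge. Shifted by \<open>s + c / 2\<close>,
  the left integrand becomes the right one on the right half of \<open>{s..s + c}\<close>, and
  \<open>cosh - 1\<close> is nonnegative on the other half.\<close>

lemma cosh_excess_integral:
  fixes b c :: real
  assumes "b > 0" "c > 0"
  shows "integral {0..c / 2} (\<lambda>x. cosh (b * (c / 2 - x)) - 1)
    \<le> integral {s..s + c} (\<lambda>x. cosh (b * (s + c - x)) - 1)"
proof -
  have "integral {0..c / 2} (\<lambda>x. cosh (b * (c / 2 - x)) - 1)
      = integral {0..c / 2} ((\<lambda>x. cosh (b * (s + c - x)) - 1) \<circ> (\<lambda>x. x + (s + c / 2)))"
    by (simp add: o_def algebra_simps)
  also have "\<dots> = integral {0 + (s + c / 2)..c / 2 + (s + c / 2)} (\<lambda>x. cosh (b * (s + c - x)) - 1)"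
    by (intro integral_shift continuous_intros)
  also have "\<dots> \<le> integral {s..s + c} (\<lambda>x. cosh (b * (s + c - x)) - 1)"
    using assms
    by (intro integral_subset_le integrable_continuous_interval continuous_intros)
      (auto simp: cosh_real_ge_1)
  finally show ?thesis .
qed

text \<open>Let \<open>?k\<close> be the left integrand and \<open>?e\<close> the excess from
  replacing \<open>\<bar>x - c / 2\<bar>\<close> by \<open>max 0 (x - c / 2)\<close>. The right
  integrand is \<open>?k - ?e\<close>, so it suffices that the integral of \<open>?e\<close> over
  \<open>{0..s + c}\<close> is at most that of \<open>?k\<close> over
  \<open>{s..s + c}\<close>.\<close>

lemma unif_laplace_integral_comparison:
  assumes "b > 0" "c > 0" "c < w"
  shows "integral {0..(w - c) / 2}
       (\<lambda>x. exp (b * c) * unif_laplace b w (x + c / 2) - unif_laplace b w \<bar>x - c / 2\<bar>)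
    \<le> integral {0..(w + c) / 2}
       (\<lambda>x. exp (b * c) * unif_laplace b w (x + c / 2) - unif_laplace b w (max 0 (x - c / 2)))"
proof -
  let ?u = "unif_laplace b w"
  define s where "s = (w - c) / 2"
  have sc: "(w + c) / 2 = s + c" "0 < s" using assms by (auto simp: s_def field_simps)
  let ?k = "\<lambda>x. exp (b * c) * ?u (x + c / 2) - ?u \<bar>x - c / 2\<bar>"
  let ?e = "\<lambda>x. ?u (max 0 (x - c / 2)) - ?u \<bar>x - c / 2\<bar>"
  have w: "w > 0" using assms by simp
  have [continuous_intros]: "continuous_on S ?k" "continuous_on S ?e" for S
    using w by (intro continuous_intros; simp)+
  \<comment> \<open>On this range \<open>x + c / 2\<close> lies in the tail branch and
    \<open>\<bar>x - c / 2\<bar>\<close> in the central one. With \<open>y = x - c / 2\<close>, the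
    addition theorem for \<open>cosh\<close> collapses the difference, and
    \<open>s + c - x = w / 2 - y\<close>.\<close>
  have k: "?k x = (cosh (b * (s + c - x)) - 1) / w" if "x \<in> {s..s + c}" for x
  proof -
    have "?u \<bar>x - c / 2\<bar> = (1 - exp (- (b * w / 2)) * cosh (b * (x - c / 2))) / w"
    proof -
      have "cosh (b * \<bar>x - c / 2\<bar>) = cosh (b * (x - c / 2))"
        by (metis abs_mult_pos' assms(1) cosh_real_abs less_imp_le)
      moreover have "\<bar>x - c / 2\<bar> \<le> w / 2" using that assms by (auto simp: s_def field_simps)
      ultimately show ?thesis by (simp add: unif_laplace_def)
    qed
    moreover have "w / 2 \<le> x + c / 2" using that by (auto simp: s_def field_simps)
    moreover have "exp (b * c) * (exp (- (b * (y + c))) * sinh (b * w / 2) / w)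
        - (1 - exp (- (b * w / 2)) * cosh (b * y)) / w = (cosh (b * (w / 2 - y)) - 1) / w" for y
    proof -
      have "exp (b * c) * exp (- (b * (y + c))) = cosh (b * y) - sinh (b * y)"
        by (simp add: cosh_minus_sinh algebra_simps flip: exp_add)
      then have e1: "exp (b * c) * (exp (- (b * (y + c))) * sinh (b * w / 2) / w)
          = (cosh (b * y) - sinh (b * y)) * sinh (b * w / 2) / w"
        by simp
      have e2: "exp (- (b * w / 2)) = cosh (b * w / 2) - sinh (b * w / 2)"
        by (simp add: cosh_minus_sinh)
      have e3: "cosh (b * (w / 2 - y)) = cosh (b * w / 2) * cosh (b * y) - sinh (b * w / 2) * sinh (b * y)"
        by (simp add: right_diff_distrib cosh_diff)
      show ?thesis
        unfolding e1 e2 e3 diff_divide_distrib[symmetric] by (simp add: algebra_simps)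
    qed
    from this[of "x - c / 2"]
    have "exp (b * c) * (exp (- (b * (x + c / 2))) * sinh (b * w / 2) / w)
        - (1 - exp (- (b * w / 2)) * cosh (b * (x - c / 2))) / w = (cosh (b * (s + c - x)) - 1) / w"
      by (simp add: s_def field_simps)
    ultimately show ?thesis
      by (simp add: unif_laplace_outer)
  qed
  \<comment> \<open>Here \<open>max 0 (x - c / 2) = 0\<close>, so the density is compared with its
    mode. Beyond \<open>c / 2\<close> the two arguments coincide and \<open>?e\<close>
    vanishes.\<close>
  have e: "?e x = exp (- (b * w / 2)) / w * (cosh (b * (c / 2 - x)) - 1)" if "x \<in> {0..c / 2}" for x
    using that assms by (simp add: unif_laplace_def max_def field_simps)
  have "integral {0..s + c} ?e = integral {0..c / 2} ?e + integral {c / 2..s + c} ?e"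
    using assms sc
    by (intro Henstock_Kurzweil_Integration.integral_combine[symmetric]
        integrable_continuous_interval continuous_intros) auto
  also have "integral {c / 2..s + c} ?e = integral {c / 2..s + c} (\<lambda>_. 0)"
    by (intro integral_cong) auto
  also have "integral {0..c / 2} ?e
      = exp (- (b * w / 2)) / w * integral {0..c / 2} (\<lambda>x. cosh (b * (c / 2 - x)) - 1)"
    using integral_cong[of "{0..c / 2}" ?e, OF e] by simp
  \<comment> \<open>The factor \<open>exp (- (b * w / 2))\<close> is at most 1; without it both
    sides carry the same factor \<open>1 / w\<close>.\<close>
  also have "\<dots> \<le> 1 / w * integral {0..c / 2} (\<lambda>x. cosh (b * (c / 2 - x)) - 1)"
    using assms w
    by (intro mult_right_mono divide_right_mono integral_nonneg
        integrable_continuous_interval continuous_intros)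
      (auto simp: cosh_real_ge_1)
  also have "\<dots> \<le> 1 / w * integral {s..s + c} (\<lambda>x. cosh (b * (s + c - x)) - 1)"
    using w by (intro mult_left_mono cosh_excess_integral assms) auto
  also have "\<dots> = integral {s..s + c} ?k"
    using integral_cong[of "{s..s + c}" ?k, OF k] by simp
  finally have *: "integral {0..s + c} ?e \<le> integral {s..s + c} ?k"
    by simp
  have "integral {0..s + c} (\<lambda>x. exp (b * c) * ?u (x + c / 2) - ?u (max 0 (x - c / 2)))
      = integral {0..s + c} (\<lambda>x. ?k x - ?e x)"
    by simp
  also have "\<dots> = integral {0..s + c} ?k - integral {0..s + c} ?e"
    by (intro integral_diff integrable_continuous_interval continuous_intros)
  also have "integral {0..s + c} ?k = integral {0..s} ?k + integral {s..s + c} ?k"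
    using assms sc
    by (intro Henstock_Kurzweil_Integration.integral_combine[symmetric]
        integrable_continuous_interval continuous_intros) auto
  finally show ?thesis
    using * by (simp add: sc(1) flip: s_def)
qed

text \<open>The argument of the logarithm in \<^const>\<open>loss_bound\<close>.\<close>

definition loss_arg :: "real \<Rightarrow> real \<Rightarrow> real \<Rightarrow> real" where
  "loss_arg b c w =
     exp (b * c) * (1 - 2 * integral {0..(w - c) / 2} (\<lambda>x. integral {0..w} (Phi b w x))) +
     2 * integral {0..(w - c) / 2} (\<lambda>x. integral {- c..w - c} (Phi b w x))"

text \<open>Both inner integrals are values of \<open>unif_laplace\<close>, the second after a
  translation by \<open>c\<close>. Substituting \<open>s - x\<close> for \<open>x\<close>, with
  \<open>s = (w - c) / 2\<close>, then turns \<open>\<bar>x - w / 2\<bar>\<close> into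
  \<open>x + c / 2\<close> and \<open>\<bar>x + c - w / 2\<bar>\<close> into
  \<open>\<bar>x - c / 2\<bar>\<close>.\<close>

lemma loss_arg_eq:
  assumes "b > 0" "c > 0" "c < w"
  shows "loss_arg b c w = exp (b * c) - 2 * integral {0..(w - c) / 2}
       (\<lambda>x. exp (b * c) * unif_laplace b w (x + c / 2) - unif_laplace b w \<bar>x - c / 2\<bar>)"
proof -
  let ?u = "unif_laplace b w"
  define s where "s = (w - c) / 2"
  have w: "w > 0" using assms by simp
  have 1: "integral {0..w} (Phi b w x) = ?u \<bar>x - w / 2\<bar>" for x
    using Phi_has_integral[OF assms(1) w] by (rule integral_unique)
  have "integral {- c..w - c} (Phi b w x) = integral {0..w} (Phi b w (x + c))" for x
  proof -
    have "integral {0 - c..w - c} (\<lambda>y. Phi b w (x + c) (y + c)) = integral {0..w} (Phi b w (x + c))"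
      by (rule integral_shift_real_ivl)
    moreover have "Phi b w (x + c) (y + c) = Phi b w x y" for y by (simp add: Phi_def)
    ultimately show ?thesis by (metis (no_types, lifting) diff_0 integral_cong)
  qed
  then have 2: "integral {- c..w - c} (Phi b w x) = ?u \<bar>x + c - w / 2\<bar>" for x
    by (simp add: 1)
  have I1: "integral {0..s} (\<lambda>x. ?u \<bar>x - w / 2\<bar>) = integral {0..s} (\<lambda>x. ?u (x + c / 2))"
  proof -
    have "integral {0..s} (\<lambda>x. ?u (s - x + c / 2)) = integral {0..s} (\<lambda>x. ?u (x + c / 2))"
      using w by (intro integral_reflect_interval[of s "\<lambda>x. ?u (x + c / 2)"] continuous_intros)
    moreover have "?u \<bar>x - w / 2\<bar> = ?u (s - x + c / 2)" if "x \<in> {0..s}" for x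
      using that assms by (auto simp: s_def field_simps intro!: arg_cong[of _ _ ?u])
    ultimately show ?thesis by (metis (no_types, lifting) integral_cong)
  qed
  have I2: "integral {0..s} (\<lambda>x. ?u \<bar>x + c - w / 2\<bar>) = integral {0..s} (\<lambda>x. ?u \<bar>x - c / 2\<bar>)"
  proof -
    have "integral {0..s} (\<lambda>x. ?u \<bar>s - x - c / 2\<bar>) = integral {0..s} (\<lambda>x. ?u \<bar>x - c / 2\<bar>)"
      using w by (intro integral_reflect_interval[of s "\<lambda>x. ?u \<bar>x - c / 2\<bar>"] continuous_intros)
    moreover have "\<bar>x + c - w / 2\<bar> = \<bar>s - x - c / 2\<bar>" for x
      using abs_minus_cancel[of "x + c - w / 2"] by (simp add: s_def diff_divide_distrib)
    ultimately show ?thesis by simp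
  qed
  have "integral {0..s} (\<lambda>x. exp (b * c) * ?u (x + c / 2) - ?u \<bar>x - c / 2\<bar>)
     = exp (b * c) * integral {0..s} (\<lambda>x. ?u (x + c / 2)) - integral {0..s} (\<lambda>x. ?u \<bar>x - c / 2\<bar>)"
    using w by (subst integral_diff) (auto intro!: integrable_continuous_interval continuous_intros)
  then show ?thesis
    unfolding loss_arg_def 1 2 by (simp add: I1 I2 algebra_simps flip: s_def)
qed

text \<open>\<open>\<nu>\<close> is the centre of the actual density, \<open>\<mu>\<close> a
  reference centre, and \<open>G\<close> divides the largest by the smallest density value over all
  centres within \<open>c / 2\<close> of \<open>\<mu>\<close>. Its mean is controlled through the
  deficit \<open>exp (b * c) - G\<close>, nonnegative by \<open>unif_laplace_ratio\<close>.\<close>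

lemma loss_ratio_integral:
  assumes bcw: "b > 0" "c > 0" "c < w" and \<nu>: "\<bar>\<nu> - \<mu>\<bar> \<le> c / 2"
    and int: "integrable lborel (\<lambda>y. unif_laplace b w \<bar>y - \<nu>\<bar>)"
    and one: "(\<integral>y. unif_laplace b w \<bar>y - \<nu>\<bar> \<partial>lborel) = 1"
    and G: "\<And>y. G y = unif_laplace b w (max 0 (\<bar>y - \<mu>\<bar> - c / 2)) / unif_laplace b w (\<bar>y - \<mu>\<bar> + c / 2)"
  shows "continuous_on UNIV G" "\<And>y. 1 \<le> G y" "\<And>y. G y \<le> exp (b * c)"
    and "(\<integral>y. unif_laplace b w \<bar>y - \<nu>\<bar> * G y \<partial>lborel) \<le> loss_arg b c w"
proof -
  let ?u = "unif_laplace b w"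
  let ?p = "\<lambda>y. ?u \<bar>y - \<nu>\<bar>"
  define h where "h d = exp (b * c) * ?u (d + c / 2) - ?u (max 0 (d - c / 2))" for d
  have w: "w > 0" using bcw by simp
  have pos: "?u (\<bar>y\<bar> + c / 2) > 0" for y
    using bcw w by (intro unif_laplace_pos) auto
  show cont: "continuous_on UNIV G"
    unfolding G[abs_def] using w pos by (intro continuous_intros) (auto simp: less_le)
  show ge1: "1 \<le> G y" for y
    using unif_laplace_antimono[OF bcw(1) w, of "max 0 (\<bar>y - \<mu>\<bar> - c / 2)" "\<bar>y - \<mu>\<bar> + c / 2"] bcw pos
    by (simp add: G)
  have h: "0 \<le> h d" if "0 \<le> d" for d
  proof -
    have "?u (max 0 (d - c / 2)) \<le> exp (b * (d + c / 2 - max 0 (d - c / 2))) * ?u (d + c / 2)"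
      using bcw w that by (intro unif_laplace_ratio) auto
    also have "\<dots> \<le> exp (b * c) * ?u (d + c / 2)"
      using bcw w that pos[of d] by (intro mult_right_mono) auto
    finally show ?thesis by (simp add: h_def)
  qed
  show le: "G y \<le> exp (b * c)" for y
    using h[of "\<bar>y - \<mu>\<bar>"] pos[of "y - \<mu>"] by (simp add: h_def G field_simps)
  \<comment> \<open>Since \<open>\<bar>y - \<nu>\<bar> \<le> \<bar>y - \<mu>\<bar> + c / 2\<close>,
    the density is at least the denominator of \<open>G\<close>, and that denominator times the
    deficit is \<open>h\<close>.\<close>
  have ph: "h \<bar>y - \<mu>\<bar> \<le> ?p y * (exp (b * c) - G y)" for y
  proof -
    have "h \<bar>y - \<mu>\<bar> = ?u (\<bar>y - \<mu>\<bar> + c / 2) * (exp (b * c) - G y)"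
      using pos[of "y - \<mu>"] by (simp add: h_def G field_simps)
    also have "\<dots> \<le> ?p y * (exp (b * c) - G y)"
      using bcw w \<nu> le[of y] by (intro mult_right_mono unif_laplace_antimono) linarith+
    finally show ?thesis .
  qed
  \<comment> \<open>The upper limit in \<open>unif_laplace_integral_comparison\<close>. Beyond
    \<open>r\<close> both values in \<open>h\<close> are in the exponential tail and cancel, so
    restricting to \<open>S\<close>, justified by \<open>0 \<le> h\<close>, loses nothing.\<close>
  define r where "r = (w + c) / 2"
  define S where "S = {\<mu> - r..\<mu> + r}"
  have hc: "continuous_on T (\<lambda>y. h \<bar>y - \<mu>\<bar>)" for T
    unfolding h_def using w by (intro continuous_intros)
  have G_int: "integrable lborel (\<lambda>y. ?p y * G y)"
  proof (rule Bochner_Integration.integrable_bound[OF integrable_mult_right[OF int, of "exp (b * c)"]])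
    show "(\<lambda>y. ?p y * G y) \<in> borel_measurable lborel"
      using w cont
      by (intro borel_measurable_times) (auto intro!: borel_measurable_continuous_onI continuous_intros)
    show "AE y in lborel. norm (?p y * G y) \<le> norm (exp (b * c) * ?p y)"
    proof (rule AE_I2)
      fix y
      have "0 \<le> ?p y" using unif_laplace_pos[OF bcw(1) w, of "\<bar>y - \<nu>\<bar>"] by simp
      then show "norm (?p y * G y) \<le> norm (exp (b * c) * ?p y)"
        using ge1[of y] le[of y] mult_right_mono[OF le[of y] \<open>0 \<le> ?p y\<close>] by (simp add: abs_mult mult.commute)
    qed
  qed
  have "((\<lambda>x. h \<bar>x\<bar>) has_integral 2 * integral {0..r} h) {- r..r}"
    using bcw w unfolding h_def r_def by (intro integral_even continuous_intros) auto
  then have "((\<lambda>y. h \<bar>y - \<mu>\<bar>) has_integral 2 * integral {0..r} h) S"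
    using has_integral_shift_Icc_real[of "\<lambda>y. h \<bar>y - \<mu>\<bar>" \<mu> _ "- r" r] by (simp add: S_def o_def add.commute)
  moreover have "set_integrable lborel S (\<lambda>y. h \<bar>y - \<mu>\<bar>)"
    unfolding S_def by (intro borel_integrable_atLeastAtMost' hc)
  ultimately have hS: "2 * integral {0..r} h = (\<integral>y. indicator S y * h \<bar>y - \<mu>\<bar> \<partial>lborel)"
      and hSi: "integrable lborel (\<lambda>y. indicator S y * h \<bar>y - \<mu>\<bar>)"
    using set_borel_integral_eq_integral(2)[of S "\<lambda>y. h \<bar>y - \<mu>\<bar>"]
    by (auto simp: integral_unique set_lebesgue_integral_def set_integrable_def)
  have "exp (b * c) - loss_arg b c w \<le> 2 * integral {0..r} h"
    using unif_laplace_integral_comparison[OF bcw]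
    by (simp add: loss_arg_eq[OF bcw] h_def[abs_def] r_def)
  also have "\<dots> \<le> (\<integral>y. ?p y * (exp (b * c) - G y) \<partial>lborel)"
    unfolding hS
  proof (rule integral_mono[OF hSi])
    show "integrable lborel (\<lambda>y. ?p y * (exp (b * c) - G y))"
      using int G_int by (simp add: right_diff_distrib)
    show "indicator S y * h \<bar>y - \<mu>\<bar> \<le> ?p y * (exp (b * c) - G y)" for y
      using ph[of y] h[of "\<bar>y - \<mu>\<bar>"] by (auto simp: indicator_def)
  qed
  also have "\<dots> = exp (b * c) - (\<integral>y. ?p y * G y \<partial>lborel)"
    using int G_int one by (simp add: right_diff_distrib)
  finally show "(\<integral>y. ?p y * G y \<partial>lborel) \<le> loss_arg b c w" by simp
qed

section \<open>The law of a coordinate\<close>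

text \<open>The Laplace density is the average of the exponential density and its mirror
  image.\<close>

lemma prob_space_laplace:
  assumes "b > 0"
  shows "prob_space (laplace b)"
proof (rule prob_spaceI)
  interpret E: prob_space "density lborel (exponential_density b)"
    using assms by (rule prob_space_exponential_density)
  let ?e = "\<lambda>x. ennreal (exponential_density b x)"
  have e: "(\<integral>\<^sup>+x. ?e x \<partial>lborel) = 1"
    using E.emeasure_space_1 by (simp add: emeasure_density)
  then have "(\<integral>\<^sup>+x. ?e (- x) \<partial>lborel) = 1"
    using nn_integral_real_affine[of ?e "-1" 0] by simp
  with e have "(\<integral>\<^sup>+x. ennreal (1 / 2) * (?e x + ?e (- x)) \<partial>lborel) = ennreal (1 / 2) * 2"
    by (simp add: nn_integral_cmult nn_integral_add)
  also have "\<dots> = ennreal (1 / 2 * 2)"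
    by (subst ennreal_mult) auto
  finally have "(\<integral>\<^sup>+x. ennreal (1 / 2) * (?e x + ?e (- x)) \<partial>lborel) = 1"
    by simp
  also have "(\<integral>\<^sup>+x. ennreal (1 / 2) * (?e x + ?e (- x)) \<partial>lborel)
      = (\<integral>\<^sup>+x. ennreal (b / 2 * exp (- b * \<bar>x\<bar>)) \<partial>lborel)"
  proof (rule nn_integral_cong_AE)
    \<comment> \<open>At 0 both one-sided densities equal \<open>b\<close>, so the average is
      \<open>b\<close> instead of \<open>b / 2\<close> there.\<close>
    show "AE x in lborel. ennreal (1 / 2) * (?e x + ?e (- x)) = ennreal (b / 2 * exp (- b * \<bar>x\<bar>))"
      using AE_lborel_singleton[of "0::real"]
    proof eventually_elim
      case (elim x)
      have "0 \<le> exponential_density b y" for y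
        using assms by (simp add: exponential_density_def)
      then have "ennreal (1 / 2) * (?e x + ?e (- x))
          = ennreal (1 / 2 * (exponential_density b x + exponential_density b (- x)))"
        by (subst ennreal_mult) (simp_all add: ennreal_plus)
      also have "1 / 2 * (exponential_density b x + exponential_density b (- x))
          = b / 2 * exp (- b * \<bar>x\<bar>)"
        using elim by (auto simp: exponential_density_def abs_if mult.commute)
      finally show ?case .
    qed
  qed
  finally show "emeasure (laplace b) (space (laplace b)) = 1"
    by (simp add: laplace_def emeasure_density)
qed

lemma sets_laplace [simp, measurable_cong]: "sets (laplace b) = sets borel"
  by (simp add: laplace_def)

lemma borel_measurable_vec_lambda:
  fixes f :: "'a \<Rightarrow> 'd::finite \<Rightarrow> real"
  assumes "\<And>l. (\<lambda>x. f x l) \<in> borel_measurable M"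
  shows "(\<lambda>x. \<chi> l. f x l) \<in> borel_measurable M"
proof -
  have "(\<lambda>x. \<Sum>l\<in>UNIV. f x l *\<^sub>R axis l (1::real)) \<in> borel_measurable M"
    using assms by (intro borel_measurable_sum borel_measurable_scaleR) auto
  moreover have "(\<Sum>l\<in>UNIV. f x l *\<^sub>R axis l 1) = (\<chi> l. f x l)" for x
    using basis_expansion[of "\<chi> l. f x l"] by (simp add: scalar_mult_eq_scaleR)
  ultimately show ?thesis by simp
qed

lemma measurable_laplace_vec:
  "(\<lambda>g. \<chi> l. g l) \<in> borel_measurable (Pi\<^sub>M (UNIV :: 'd::finite set) (\<lambda>_. laplace b))"
proof (rule borel_measurable_vec_lambda)
  fix l :: 'd
  have "(\<lambda>g. g l) \<in> measurable (Pi\<^sub>M UNIV (\<lambda>_. laplace b)) (laplace b)"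
    by (rule measurable_component_singleton) simp
  then show "(\<lambda>g. g l) \<in> borel_measurable (Pi\<^sub>M UNIV (\<lambda>_. laplace b))"
    by (simp cong: measurable_cong_sets)
qed

lemma sets_laplace_vec [simp, measurable_cong]: "sets (laplace_vec b) = sets borel"
  by (simp add: laplace_vec_def)

lemma prob_space_laplace_vec:
  assumes "b > 0"
  shows "prob_space (laplace_vec b :: (real^'d) measure)"
proof -
  have "prob_space (Pi\<^sub>M (UNIV :: 'd set) (\<lambda>_. laplace b))"
    by (intro prob_space_PiM prob_space_laplace assms)
  then show ?thesis
    unfolding laplace_vec_def using measurable_laplace_vec by (rule prob_space.prob_space_distr)
qed

lemma distr_laplace_vec_component:
  assumes "b > 0"
  shows "distr (laplace_vec b) borel (\<lambda>v :: real^'d. v $ l) = laplace b"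
proof -
  have "distr (laplace_vec b) borel (\<lambda>v :: real^'d. v $ l)
      = distr (Pi\<^sub>M (UNIV :: 'd set) (\<lambda>_. laplace b)) borel (\<lambda>g. g l)"
    unfolding laplace_vec_def
    by (subst distr_distr) (auto simp: o_def intro!: measurable_laplace_vec)
  also have "\<dots> = distr (Pi\<^sub>M (UNIV :: 'd set) (\<lambda>_. laplace b)) (laplace b) (\<lambda>g. g l)"
    by (intro distr_cong) auto
  also have "\<dots> = laplace b"
    using assms by (intro distr_PiM_component prob_space_laplace) auto
  finally show ?thesis .
qed

text \<open>Recovers an interval from its length alone, whichever endpoints it contains; the witness
  for \<open>a\<close> is the infimum.\<close>

lemma convex_real_interval_hull:
  fixes S :: "real set"
  assumes "convex S" "w = measure lborel S" "w > 0"
  obtains a where "{a<..<a + w} \<subseteq> S" "S \<subseteq> {a..a + w}"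
proof -
  have int: "{x..y} \<subseteq> S" if "x \<in> S" "y \<in> S" for x y
  proof
    fix z assume "z \<in> {x..y}"
    moreover have "is_interval S" using assms(1) by (simp add: is_interval_convex_1)
    ultimately show "z \<in> S" using mem_is_interval_1_I[of S x y z] that by auto
  qed
  have S: "S \<in> sets lborel"
    using assms(1) by (simp add: real_interval_borel_measurable is_interval_convex_1)
  \<comment> \<open>\<open>measure\<close> is 0 on sets of infinite measure, which
    \<open>w > 0\<close> excludes.\<close>
  have "emeasure lborel S \<noteq> \<infinity>"
    using assms(2,3) by (auto simp: measure_def)
  then have S': "emeasure lborel S = ennreal w"
    using assms(2) by (simp add: emeasure_eq_ennreal_measure)
  have diam: "y - x \<le> w" if "x \<in> S" "y \<in> S" for x y
  proof (cases "x \<le> y")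
    case True
    have "emeasure lborel {x..y} \<le> emeasure lborel S"
      using int[OF that] S by (intro emeasure_mono)
    then show ?thesis using S' True assms(3) by (simp add: ennreal_le_iff)
  qed (use assms in simp)
  have ne: "S \<noteq> {}" using assms by auto
  then obtain x0 where x0: "x0 \<in> S" by blast
  have bdd: "bdd_above S" "bdd_below S"
    using diam[OF x0] diam[OF _ x0]
    by (auto intro!: bdd_aboveI[of _ "x0 + w"] bdd_belowI[of _ "x0 - w"] simp: algebra_simps)
  have sub1: "{Inf S<..<Sup S} \<subseteq> S"
  proof
    fix z assume "z \<in> {Inf S<..<Sup S}"
    then obtain x y where "x \<in> S" "x < z" "y \<in> S" "z < y"
      using bdd ne by (auto simp: cInf_less_iff less_cSup_iff)
    then show "z \<in> S" using int[of x y] by auto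
  qed
  have sub2: "S \<subseteq> {Inf S..Sup S}"
    using bdd by (auto intro: cInf_lower cSup_upper)
  have le: "Inf S \<le> Sup S" using sub2 ne by fastforce
  have "emeasure lborel {Inf S<..<Sup S} \<le> emeasure lborel S"
    using sub1 S by (intro emeasure_mono)
  moreover have "emeasure lborel S \<le> emeasure lborel {Inf S..Sup S}"
    using sub2 by (intro emeasure_mono) auto
  ultimately have "ennreal (Sup S - Inf S) = ennreal w"
    using S' le by (intro antisym) simp_all
  then have "Sup S = Inf S + w"
    using le assms(3) by (simp add: ennreal_inj)
  then show thesis using that[of "Inf S"] sub1 sub2 by simp
qed

text \<open>\<open>S\<close> has two distinct points, so the point-mass branch of
  \<open>uniform_on\<close> is excluded, and it differs from the closed interval in at most the
  endpoints, a null set.\<close>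

lemma uniform_on_interval:
  fixes S :: "real set"
  assumes "convex S" "w > 0" "{a<..<a + w} \<subseteq> S" "S \<subseteq> {a..a + w}"
  shows "uniform_on S = density lborel (\<lambda>x. ennreal (1 / w) * indicator {a..a + w} x)"
proof -
  have "a + w / 3 \<in> S" "a + w / 2 \<in> S"
    using assms(2,3) by (auto simp: subset_iff field_simps)
  then have nsing: "\<not> is_singleton S"
    using assms(2) by (fastforce simp: is_singleton_def)
  have S: "S \<in> sets borel"
    using assms(1) by (intro real_interval_borel_measurable) (simp add: is_interval_convex_1)
  have AE: "AE x in lborel. (indicator S x :: ennreal) = indicator {a..a + w} x"
    using AE_lborel_singleton[of a] AE_lborel_singleton[of "a + w"]
  proof eventually_elim
    case (elim x)
    then show ?case using assms(3,4) by (auto simp: indicator_def subset_iff)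
  qed
  then have "AE x in lborel. x \<in> S \<longleftrightarrow> x \<in> {a..a + w}"
    by eventually_elim (auto simp: indicator_def of_bool_def split: if_splits)
  then have "emeasure lborel S = emeasure lborel {a..a + w}"
    using S by (intro emeasure_eq_AE) auto
  then have "uniform_measure lborel S = density lborel (\<lambda>x. indicator S x / ennreal w)"
    using assms(2) by (simp add: uniform_measure_def)
  also have "\<dots> = density lborel (\<lambda>x. ennreal (1 / w) * indicator {a..a + w} x)"
  proof (rule density_cong)
    show "AE x in lborel. indicator S x / ennreal w = ennreal (1 / w) * indicator {a..a + w} x"
      using AE
    proof eventually_elim
      case (elim x)
      show ?case
        unfolding elim using divide_ennreal[of 1 w] assms(2) by (simp add: indicator_def)
    qed
  qed (use S in auto)
  finally show ?thesis
    using nsing by (simp add: uniform_on_def)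
qed

text \<open>The product of the two densities is \<open>Phi\<close> restricted to the interval, so
  \<open>Phi_has_integral\<close>, translated by \<open>a\<close>, evaluates the
  convolution.\<close>

lemma convolution_laplace_uniform:
  assumes "b > 0" "w > 0"
  shows "convolution (laplace b) (density lborel (\<lambda>x. ennreal (1 / w) * indicator {a..a + w} x))
    = density lborel (\<lambda>z. ennreal (unif_laplace b w \<bar>z - (a + w / 2)\<bar>))"
proof -
  have fin: "finite_measure (density lborel (\<lambda>x. ennreal (1 / w) * indicator {a..a + w} x))"
    using assms by (intro finite_measureI) (simp add: emeasure_density nn_integral_cmult_indicator
        ennreal_mult_eq_top_iff)
  have "(\<integral>\<^sup>+y. ennreal (b / 2 * exp (- b * \<bar>z - y\<bar>)) * (ennreal (1 / w) * indicator {a..a + w} y) \<partial>lborel)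
      = ennreal (unif_laplace b w \<bar>z - (a + w / 2)\<bar>)" for z
  proof -
    have "((\<lambda>y. Phi b w (z - a) (y - a)) has_integral unif_laplace b w \<bar>z - a - w / 2\<bar>) {0 + a..w + a}"
      using Phi_has_integral[OF assms, of "z - a"]
      by (subst has_integral_shift_Icc_real[symmetric]) (simp add: o_def)
    then have "(Phi b w z has_integral unif_laplace b w \<bar>z - (a + w / 2)\<bar>) {a..a + w}"
      by (simp add: Phi_def[abs_def] add.commute diff_diff_eq)
    from nn_integral_has_integral_lebesgue'[OF _ this]
    have "(\<integral>\<^sup>+y. ennreal (Phi b w z y) * indicator {a..a + w} y \<partial>lborel)
        = ennreal (unif_laplace b w \<bar>z - (a + w / 2)\<bar>)"
      using assms by (simp add: Phi_def)
    moreover have "ennreal (b / 2 * exp (- b * \<bar>z - y\<bar>)) * (ennreal (1 / w) * indicator {a..a + w} y)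
        = ennreal (Phi b w z y) * indicator {a..a + w} y" for y
      using assms by (cases "y \<in> {a..a + w}") (auto simp: Phi_def field_simps simp flip: ennreal_mult)
    ultimately show ?thesis by simp
  qed
  then show ?thesis
    unfolding laplace_def
    using prob_space.finite_measure[OF prob_space_laplace[OF assms(1)]]
    by (subst convolution_density) (auto simp: fin laplace_def prob_space_def)
qed

section \<open>Law of a coordinate after one step\<close>

lemma density_lborel_translate:
  fixes c :: real
  assumes [measurable]: "p \<in> borel_measurable borel"
  shows "distr (density lborel p) borel (\<lambda>x. x + c) = density lborel (\<lambda>x. p (x - c))"
proof -
  have "density (distr lborel borel ((+) c)) (\<lambda>x. p (x - c)) = distr (density lborel p) borel ((+) c)"
    by (subst density_distr) auto
  then show ?thesis
    by (simp add: lborel_distr_plus add.commute[of _ c])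
qed

lemma step_law_prob_space:
  assumes Q: "prob_space Q" "sets Q = sets borel" and "b > 0"
    and A: "A \<in> borel_measurable borel"
  shows "prob_space (step_law Q A c b :: (real^'d) measure)"
proof -
  interpret Q: prob_space Q by fact
  interpret V: prob_space "laplace_vec b :: (real^'d) measure" by (rule prob_space_laplace_vec) fact
  interpret QV: pair_prob_space Q "laplace_vec b :: (real^'d) measure" ..
  note Q(2)[measurable_cong] A[measurable]
  show ?thesis
    unfolding step_law_def by (rule QV.prob_space_distr) measurable
qed

text \<open>Coordinate \<open>l\<close> depends only on \<open>A w $ l\<close> and
  \<open>\<delta> $ l\<close>. Their joint law is a product of a uniform and a Laplace law; the sum
  is a convolution, then translated by \<open>c $ l\<close>.\<close>

lemma step_law_distributed:
  fixes A :: "'w::topological_space \<Rightarrow> real^'d"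
  assumes Q: "prob_space Q" "sets Q = sets borel" and bw: "b > 0" "w > 0"
    and A: "A \<in> borel_measurable borel"
    and unif: "distr Q borel (\<lambda>w. A w $ l) = density lborel (\<lambda>x. ennreal (1 / w) * indicator {a..a + w} x)"
  shows "distributed (step_law Q A c b) lborel (\<lambda>v. v $ l)
    (\<lambda>z. ennreal (unif_laplace b w \<bar>z - (a + w / 2 + c $ l)\<bar>))"
proof -
  have Al[measurable]: "(\<lambda>w. A w $ l) \<in> borel_measurable borel"
    using A by (rule measurable_compose[OF _ borel_measurable_nth])
  let ?V = "laplace_vec b :: (real^'d) measure"
  let ?U = "density lborel (\<lambda>x. ennreal (1 / w) * indicator {a..a + w} x)"
  interpret Q: prob_space Q by fact
  interpret V: prob_space ?V by (rule prob_space_laplace_vec) fact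
  interpret QV: pair_prob_space Q ?V ..
  note Q(2)[measurable_cong] A[measurable]
  have U: "prob_space ?U"
    unfolding unif[symmetric] by (rule Q.prob_space_distr) measurable
  have L: "prob_space (laplace b)" by (rule prob_space_laplace) fact
  have fst: "(\<lambda>p. A (fst p)) \<in> borel_measurable (Q \<Otimes>\<^sub>M ?V)"
    using A Q(2) by (intro measurable_compose[OF measurable_fst]) (simp cong: measurable_cong_sets)
  have snd: "snd \<in> borel_measurable (Q \<Otimes>\<^sub>M ?V)"
    using measurable_snd[of Q ?V] by (simp cong: measurable_cong_sets)
  have [measurable]: "(\<lambda>(w, \<delta>). (A w $ l, \<delta> $ l)) \<in> measurable (Q \<Otimes>\<^sub>M ?V) (borel \<Otimes>\<^sub>M borel)"
    unfolding case_prod_unfold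
    using measurable_compose[OF fst borel_measurable_nth] measurable_compose[OF snd borel_measurable_nth]
    by (intro measurable_Pair)
  have [measurable]: "(\<lambda>(w, \<delta>). A w + c + \<delta>) \<in> borel_measurable (Q \<Otimes>\<^sub>M ?V)"
    unfolding case_prod_unfold by (intro borel_measurable_add fst snd) simp
  have [measurable]: "(\<lambda>(x, y). x + y + c $ l) \<in> borel_measurable (borel \<Otimes>\<^sub>M borel)"
    by measurable
  have "distr (step_law Q A c b) borel (\<lambda>v. v $ l)
      = distr (Q \<Otimes>\<^sub>M ?V) borel ((\<lambda>v. v $ l) \<circ> (\<lambda>(w, \<delta>). A w + c + \<delta>))"
    unfolding step_law_def by (rule distr_distr) simp_all
  also have "(\<lambda>v. v $ l) \<circ> (\<lambda>(w, \<delta>). A w + c + \<delta>)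
      = (\<lambda>(x, y). x + y + c $ l) \<circ> (\<lambda>(w, \<delta>). (A w $ l, \<delta> $ l))"
    by (auto simp: fun_eq_iff)
  also have "distr (Q \<Otimes>\<^sub>M ?V) borel \<dots>
      = distr (distr (Q \<Otimes>\<^sub>M ?V) (borel \<Otimes>\<^sub>M borel) (\<lambda>(w, \<delta>). (A w $ l, \<delta> $ l))) borel
          (\<lambda>(x, y). x + y + c $ l)"
    by (rule distr_distr[symmetric]) fact+
  also have "distr (Q \<Otimes>\<^sub>M ?V) (borel \<Otimes>\<^sub>M borel) (\<lambda>(w, \<delta>). (A w $ l, \<delta> $ l))
      = distr Q borel (\<lambda>w. A w $ l) \<Otimes>\<^sub>M distr ?V borel (\<lambda>\<delta>. \<delta> $ l)"
  proof (rule pair_measure_distr[symmetric])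
    show "(\<lambda>w. A w $ l) \<in> borel_measurable Q"
      using Al by (subst measurable_cong_sets[OF Q(2) refl])
    show "(\<lambda>\<delta>. \<delta> $ l) \<in> borel_measurable ?V"
      by (subst measurable_cong_sets[OF sets_laplace_vec refl]) (rule borel_measurable_nth)
    show "sigma_finite_measure (distr ?V borel (\<lambda>\<delta>. \<delta> $ l))"
      unfolding distr_laplace_vec_component[OF bw(1)] using L by (rule prob_space_imp_sigma_finite)
  qed
  also have "\<dots> = ?U \<Otimes>\<^sub>M laplace b"
    by (simp add: unif distr_laplace_vec_component bw)
  also have "(\<lambda>(x, y). x + y + c $ l) = (\<lambda>x. x + c $ l) \<circ> (\<lambda>(x, y). x + y)"
    by (auto simp: fun_eq_iff)
  also have "distr (?U \<Otimes>\<^sub>M laplace b) borel \<dots> = distr (convolution ?U (laplace b)) borel (\<lambda>x. x + c $ l)"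
    unfolding convolution_def by (rule distr_distr[symmetric]) measurable
  also have "convolution ?U (laplace b) = convolution (laplace b) ?U"
    using U L by (intro convolution_commutative) (auto intro: prob_space.finite_measure)
  also have "\<dots> = density lborel (\<lambda>z. ennreal (unif_laplace b w \<bar>z - (a + w / 2)\<bar>))"
    by (rule convolution_laplace_uniform) fact+
  also have "distr \<dots> borel (\<lambda>x. x + c $ l)
      = density lborel (\<lambda>z. ennreal (unif_laplace b w \<bar>z - c $ l - (a + w / 2)\<bar>))"
    using bw by (intro density_lborel_translate measurable_compose[OF _ measurable_ennreal]
        borel_measurable_continuous_onI continuous_intros)
  finally have "distr (step_law Q A c b) borel (\<lambda>v. v $ l)
      = density lborel (\<lambda>z. ennreal (unif_laplace b w \<bar>z - (a + w / 2 + c $ l)\<bar>))"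
    by (simp add: algebra_simps)
  moreover have "(\<lambda>z. ennreal (unif_laplace b w \<bar>z - (a + w / 2 + c $ l)\<bar>)) \<in> borel_measurable lborel"
    using bw by (intro measurable_compose[OF _ measurable_ennreal])
      (auto intro!: borel_measurable_continuous_onI continuous_intros)
  ultimately show ?thesis
    unfolding distributed_def by (simp add: step_law_def cong: distr_cong)
qed

section \<open>Uniqueness of the continuous density\<close>

lemma continuous_AE_eq_imp_eq:
  fixes p q :: "real \<Rightarrow> real"
  assumes "continuous_on UNIV p" "continuous_on UNIV q" "AE z in lborel. p z = q z"
  shows "p = q"
proof (rule ccontr)
  assume "p \<noteq> q"
  have "{z. p z \<noteq> q z} = - {z. p z = q z}" by auto
  then have "open {z. p z \<noteq> q z}"
    using closed_Collect_eq[OF assms(1,2)] by (simp add: open_Compl)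
  moreover have "{z. p z \<noteq> q z} \<in> null_sets lborel"
    using assms(3) \<open>open _\<close> by (subst (asm) AE_iff_null) (auto simp: Collect_neg_eq)
  then have "negligible {z. p z \<noteq> q z}"
    by (metis negligible_iff_null_sets null_sets_completionI)
  ultimately show False
    using open_not_negligible \<open>p \<noteq> q\<close> by blast
qed

text \<open>Makes the definite description in \<open>coord_density\<close> usable. Densities agree
  almost everywhere, nonnegativity removes the truncation by \<open>ennreal\<close>, and continuity
  upgrades this to equality everywhere.\<close>

lemma coord_density_eq:
  assumes "prob_space L" "continuous_on UNIV p" "\<And>z. 0 \<le> p z"
    and "distributed L lborel (\<lambda>v. v $ l) (\<lambda>z. ennreal (p z))"
  shows "coord_density L l = p"
  unfolding coord_density_def
proof (rule the_equality)
  fix q assume q: "continuous_on UNIV q \<and> (\<forall>z. 0 \<le> q z) \<and>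
     distributed L lborel (\<lambda>v. v $ l) (\<lambda>z. ennreal (q z))"
  then have "AE z in lborel. ennreal (q z) = ennreal (p z)"
    using prob_space.distributed_unique[OF assms(1) _ assms(4)] by blast
  then show "q = p"
    using q assms by (intro continuous_AE_eq_imp_eq) auto
qed (use assms in auto)

section \<open>The expected privacy loss\<close>

text \<open>The common core of both algorithms: \<open>c g\<close> is the shift caused by the
  private function \<open>g\<close>, and \<open>upd\<close> says that the law ignores the iterate
  being drawn.\<close>

lemma expected_loss_step_law_le:
  fixes A :: "'w::topological_space \<Rightarrow> real^'d" and X :: "('n::finite, 'd) trajectory"
    and c :: "(real^'d \<Rightarrow> real) \<Rightarrow> real^'d"
  assumes abB: "0 < a" "0 < b" "0 < B"
    and rw: "random_weights W A Q" and A: "A \<in> borel_measurable borel"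
    and conv: "convex ((\<lambda>w. A w $ l) ` W)"
    and w: "w = measure lborel (mean_range W A (c f) l)" "a * B < w"
    and F: "f \<in> F"
    and shift: "\<And>g h. g \<in> F \<Longrightarrow> h \<in> F \<Longrightarrow> \<bar>(c g - c h) $ l\<bar> \<le> a * B"
    and Law: "\<And>g. Law g X = step_law Q A (c g) b"
    and upd: "\<And>g z. Law g (X(k := (X k)(i := z))) = Law g X"
  shows "expected_loss F Law a b B k i l f X \<le> loss_bound a b B w"
proof -
  define C where "C = a * B"
  have C: "0 < C" "C < w" using abB w by (simp_all add: C_def)
  have w0: "w > 0" using C by simp
  let ?u = "unif_laplace b w"
  have Q: "prob_space Q" "sets Q = sets borel"
    and dA: "distr Q borel (\<lambda>w. A w $ l) = uniform_on ((\<lambda>w. A w $ l) ` W)"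
    using rw by (auto simp: random_weights_def)
  have mr: "mean_range W A (c f) l = (\<lambda>x. c f $ l + x) ` (\<lambda>w. A w $ l) ` W"
    by (auto simp: mean_range_def image_image add.commute)
  obtain a1 where a1: "{a1<..<a1 + w} \<subseteq> mean_range W A (c f) l" "mean_range W A (c f) l \<subseteq> {a1..a1 + w}"
    using convex_real_interval_hull[OF _ w(1) w0] convex_translation[OF conv] mr by metis
  \<comment> \<open>Removing the shift of \<open>f\<close> leaves the lower endpoint of the range of
    \<open>A\<close> alone, which is the same for every private function.\<close>
  define \<alpha> where "\<alpha> = a1 - c f $ l"
  have "{\<alpha><..<\<alpha> + w} \<subseteq> (\<lambda>w. A w $ l) ` W"
  proof
    fix x assume "x \<in> {\<alpha><..<\<alpha> + w}"
    then have "c f $ l + x \<in> mean_range W A (c f) l"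
      using a1(1) by (auto simp: \<alpha>_def)
    then show "x \<in> (\<lambda>w. A w $ l) ` W" by (auto simp: mr)
  qed
  moreover have "(\<lambda>w. A w $ l) ` W \<subseteq> {\<alpha>..\<alpha> + w}"
  proof
    fix x assume "x \<in> (\<lambda>w. A w $ l) ` W"
    then have "c f $ l + x \<in> mean_range W A (c f) l" unfolding mr by (rule imageI)
    then show "x \<in> {\<alpha>..\<alpha> + w}" using a1(2) by (auto simp: \<alpha>_def)
  qed
  ultimately have unif: "distr Q borel (\<lambda>w. A w $ l)
      = density lborel (\<lambda>x. ennreal (1 / w) * indicator {\<alpha>..\<alpha> + w} x)"
    unfolding dA using conv w0 by (intro uniform_on_interval)
  define \<nu> where "\<nu> g = \<alpha> + w / 2 + c g $ l" for g
  have prob: "prob_space (Law g X)" for g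
    unfolding Law by (rule step_law_prob_space) fact+
  have dist: "distributed (Law g X) lborel (\<lambda>v. v $ l) (\<lambda>y. ennreal (?u \<bar>y - \<nu> g\<bar>))" for g
    unfolding Law \<nu>_def by (rule step_law_distributed) fact+
  have pos: "0 < ?u d" if "0 \<le> d" for d
    using that abB w0 by (intro unif_laplace_pos)
  have dens: "coord_density (Law g X) l = (\<lambda>y. ?u \<bar>y - \<nu> g\<bar>)" for g
    by (intro coord_density_eq prob dist continuous_intros w0 less_imp_le[OF pos]) auto
  have "bdd_below ((\<lambda>g. \<nu> g) ` F)"
  proof (rule bdd_belowI2)
    show "\<nu> f - C \<le> \<nu> g" if "g \<in> F" for g
      using shift[OF F that] by (simp add: \<nu>_def C_def)
  qed
  \<comment> \<open>The centres differ pairwise by at most \<open>C\<close>, hence lie in an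
    interval of length \<open>C\<close> starting at their infimum; \<open>\<mu>\<close> is its
    midpoint.\<close>
  define \<mu> where "\<mu> = Inf (\<nu> ` F) + C / 2"
  have \<mu>: "\<bar>\<nu> g - \<mu>\<bar> \<le> C / 2" if g: "g \<in> F" for g
  proof -
    have "Inf (\<nu> ` F) \<le> \<nu> g"
      using \<open>bdd_below _\<close> g by (auto intro: cInf_lower)
    moreover have "\<nu> g - C \<le> Inf (\<nu> ` F)"
    proof (rule cInf_greatest)
      fix x assume "x \<in> \<nu> ` F"
      then obtain h where h: "h \<in> F" "x = \<nu> h" by blast
      then show "\<nu> g - C \<le> x" using shift[OF g h(1)] by (simp add: \<nu>_def C_def)
    qed (use F in auto)
    ultimately show ?thesis unfolding \<mu>_def by linarith
  qed
  define G where "G y = ?u (max 0 (\<bar>y - \<mu>\<bar> - C / 2)) / ?u (\<bar>y - \<mu>\<bar> + C / 2)" for y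
  have between: "?u (\<bar>y - \<mu>\<bar> + C / 2) \<le> ?u \<bar>y - \<nu> g\<bar>" "?u \<bar>y - \<nu> g\<bar> \<le> ?u (max 0 (\<bar>y - \<mu>\<bar> - C / 2))"
    if "g \<in> F" for g y
    using \<mu>[OF that] abB w0 by (intro unif_laplace_antimono; linarith)+
  have loss: "privacy_loss F Law k i l (X(k := (X k)(i := z))) \<le> ln (G (z $ l))" for z
    unfolding privacy_loss_def
  proof (rule cSUP_least)
    fix p assume p: "p \<in> F \<times> F"
    then obtain g h where gh: "p = (g, h)" "g \<in> F" "h \<in> F" by blast
    define y where "y = z $ l"
    have ratio: "?u \<bar>y - \<nu> g\<bar> / ?u \<bar>y - \<nu> h\<bar> \<le> G y" if "g \<in> F" "h \<in> F" for g h
      unfolding G_def using between[OF that(1)] between[OF that(2)] pos C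
      by (intro frac_le) (auto intro: less_imp_le)
    \<comment> \<open>The two orders of \<open>g\<close> and \<open>h\<close> yield the two signs
      under the absolute value.\<close>
    have "ln (?u \<bar>y - \<nu> g\<bar> / ?u \<bar>y - \<nu> h\<bar>) \<le> ln (G y)"
      using ratio[OF gh(2,3)] pos by (intro ln_mono) auto
    moreover have "ln (?u \<bar>y - \<nu> h\<bar> / ?u \<bar>y - \<nu> g\<bar>) \<le> ln (G y)"
      using ratio[OF gh(3,2)] pos by (intro ln_mono) auto
    ultimately have "\<bar>ln (?u \<bar>y - \<nu> g\<bar> / ?u \<bar>y - \<nu> h\<bar>)\<bar> \<le> ln (G y)"
      using pos[of "\<bar>y - \<nu> g\<bar>"] pos[of "\<bar>y - \<nu> h\<bar>"] by (simp add: ln_div abs_le_iff)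
    then show "(case p of (f, g) \<Rightarrow> \<bar>ln (coord_density (Law f (X(k := (X k)(i := z)))) l
        ((X(k := (X k)(i := z))) k i $ l) / coord_density (Law g (X(k := (X k)(i := z)))) l
        ((X(k := (X k)(i := z))) k i $ l))\<bar>) \<le> ln (G (z $ l))"
      by (simp add: gh(1) upd dens y_def)
  qed (use F in auto)
  let ?p = "\<lambda>y. ?u \<bar>y - \<nu> f\<bar>"
  interpret L: prob_space "Law f X" by (rule prob)
  have one: "(\<integral>y. ?p y \<partial>lborel) = 1"
    using distributed_integral[OF dist[of f], of "\<lambda>_. 1"] pos L.prob_space
    by (simp add: less_imp_le)
  \<comment> \<open>A non-integrable function has Bochner integral 0, so the value 1 forces
    integrability.\<close>
  then have int: "integrable lborel ?p"
    using not_integrable_integral_eq by fastforce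
  define T where "T = loss_arg b C w"
  note G = loss_ratio_integral[OF abB(2) C \<mu>[OF F] int one G_def]
  have Gm: "G \<in> borel_measurable borel"
    using G(1) by (rule borel_measurable_continuous_onI)
  have lm: "(\<lambda>v. v $ l) \<in> borel_measurable (Law f X)"
    using distributed_measurable[OF dist[of f]] by simp
  have GL: "integrable (Law f X) (\<lambda>v. G (v $ l))"
    using G(2,3) order_trans[OF zero_le_one G(2)]
    by (intro L.integrable_const_bound[of _ "exp (b * C)"] measurable_compose[OF lm Gm]) auto
  have EG: "(\<integral>v. G (v $ l) \<partial>Law f X) \<le> T"
    using distributed_integral[OF dist[of f], of G] Gm pos G(4)
    by (simp add: less_imp_le T_def)
  have "1 \<le> (\<integral>v. G (v $ l) \<partial>Law f X)"
    using L.integral_ge_const[OF GL, of 1] G(2) by simp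
  then have T: "1 \<le> T" using EG by simp
  \<comment> \<open>Replaces Jensen's inequality: \<open>ln\<close> lies below its tangent at \<open>T\<close>.\<close>
  have tangent: "ln x \<le> ln T + x / T - 1" if "x > 0" for x
    using ln_le_minus_one[of "x / T"] that T by (simp add: ln_div)
  define D where "D = a * b * B"
  have D: "D > 0" using abB by (simp add: D_def)
  have "expected_loss F Law a b B k i l f X
      \<le> (\<integral>z. (ln T + G (z $ l) / T - 1) / D \<partial>Law f X)"
    unfolding expected_loss_def D_def[symmetric]
  \<comment> \<open>This rule asks for integrability and nonnegativity of the majorant only. If the
    loss, a supremum over a possibly uncountable family, fails to be integrable, its integral is 0
    and the bound still holds.\<close>
  proof (rule integral_mono')
    show "integrable (Law f X) (\<lambda>z. (ln T + G (z $ l) / T - 1) / D)"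
      using GL by simp
    show "privacy_loss F Law k i l (X(k := (X k)(i := z))) / D \<le> (ln T + G (z $ l) / T - 1) / D" for z
    proof -
      have "G (z $ l) > 0" using G(2)[of "z $ l"] by linarith
      from order_trans[OF loss tangent[OF this]] show ?thesis
        using D by (intro divide_right_mono) auto
    qed
    show "0 \<le> (ln T + G (z $ l) / T - 1) / D" for z
    proof -
      have "0 \<le> ln (G (z $ l))" using G(2) by simp
      also have "\<dots> \<le> ln T + G (z $ l) / T - 1"
        using G(2)[of "z $ l"] by (intro tangent) linarith
      finally show ?thesis using D by simp
    qed
  qed
  also have "\<dots> = (ln T + (\<integral>z. G (z $ l) \<partial>Law f X) / T - 1) / D"
    using GL L.prob_space by simp
  \<comment> \<open>The mean of \<open>G\<close> is at most \<open>T\<close>, so the linear terms of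
    the tangent contribute at most \<open>1 - 1\<close>.\<close>
  also have "\<dots> \<le> ln T / D"
    using EG T D by (intro divide_right_mono) (auto simp: field_simps)
  also have "\<dots> = loss_bound a b B w"
    by (simp add: loss_bound_def T_def loss_arg_def C_def D_def ac_simps)
  finally show ?thesis .
qed

section \<open>The two averages: convex ranges and measurability\<close>

lemma convex_affine_image:
  assumes "convex W"
    and "\<And>x y u v. u + v = 1 \<Longrightarrow> \<phi> (u *\<^sub>R x + v *\<^sub>R y) = u *\<^sub>R \<phi> x + v *\<^sub>R \<phi> y"
  shows "convex (\<phi> ` W)"
proof (rule convexI)
  fix x y and u v :: real assume uv: "0 \<le> u" "0 \<le> v" "u + v = 1" and "x \<in> \<phi> ` W" "y \<in> \<phi> ` W"
  then obtain x' y' where xy: "x = \<phi> x'" "y = \<phi> y'" "x' \<in> W" "y' \<in> W" by blast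
  have "u *\<^sub>R x' + v *\<^sub>R y' \<in> W" using assms(1) xy uv by (simp add: convexD)
  then show "u *\<^sub>R x + v *\<^sub>R y \<in> \<phi> ` W"
    using assms(2)[OF uv(3)] xy by (metis imageI)
qed

lemma convex_combination_pos:
  fixes x y :: real
  assumes "0 \<le> u" "0 \<le> v" "u + v = 1" "0 < x" "0 < y"
  shows "0 < u * x + v * y"
  using convex_bound_lt[of "- x" 0 "- y" u v] assms by simp

lemma continuous_on_matrix_vector_mult_left [continuous_intros]:
  fixes M :: "'a::topological_space \<Rightarrow> real^'m^'n"
  assumes "continuous_on S M"
  shows "continuous_on S (\<lambda>x. M x *v v)"
  unfolding matrix_vector_mult_def using assms by (intro continuous_intros)

lemma gradient_component_le:
  assumes "sensitivity_bound C F B" "g \<in> F" "h \<in> F" "x \<in> C"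
  shows "\<bar>(gradient C g x - gradient C h x) $ l\<bar> \<le> B"
  using assms component_le_infnorm_cart[of "gradient C g x - gradient C h x" l]
  unfolding sensitivity_bound_def by force

lemma convex_admm_weights: "convex (admm_weights TYPE('n::finite) D :: ((real^'d^'d) \<times> (real^'d^'d)) set)"
proof (rule convexI)
  fix x y :: "(real^'d^'d) \<times> (real^'d^'d)" and u v :: real
  assume uv: "0 \<le> u" "0 \<le> v" "u + v = 1"
    and x: "x \<in> admm_weights TYPE('n) D" and y: "y \<in> admm_weights TYPE('n) D"
  let ?n = "real CARD('n) - 1"
  have "?n *\<^sub>R (u *\<^sub>R fst x + v *\<^sub>R fst y) + (u *\<^sub>R snd x + v *\<^sub>R snd y)
      = u *\<^sub>R (?n *\<^sub>R fst x + snd x) + v *\<^sub>R (?n *\<^sub>R fst y + snd y)"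
    by (simp add: algebra_simps)
  also have "\<dots> = u *\<^sub>R D *\<^sub>R mat 1 + v *\<^sub>R D *\<^sub>R mat 1"
    using x y by (auto simp: admm_weights_def)
  also have "\<dots> = D *\<^sub>R mat 1"
    using uv(3) by (metis scaleR_add_left scaleR_one)
  finally show "u *\<^sub>R x + v *\<^sub>R y \<in> admm_weights TYPE('n) D"
    using x y convex_combination_pos[OF uv]
    by (auto simp: admm_weights_def diagonal_mat_def)
qed

lemma convex_dgd_weights: "convex (dgd_weights :: (real^'d^'d) set)"
proof (rule convexI)
  fix x y :: "real^'d^'d" and u v :: real
  assume uv: "0 \<le> u" "0 \<le> v" "u + v = 1" and xy: "x \<in> dgd_weights" "y \<in> dgd_weights"
  have "u * x $ l $ l + v * y $ l $ l < 1" for l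
    using xy by (intro convex_bound_lt uv) (auto simp: dgd_weights_def)
  then show "u *\<^sub>R x + v *\<^sub>R y \<in> dgd_weights"
    using xy convex_combination_pos[OF uv] by (auto simp: dgd_weights_def diagonal_mat_def)
qed

text \<open>Convexity of the range is what makes it an interval, so that its measure
  \<open>w\<close> determines the uniform law of the coordinate.\<close>

lemma convex_admm_average: "convex ((\<lambda>w. admm_average D i x w $ l) ` admm_weights TYPE('n::finite) D)"
  by (rule convex_affine_image[OF convex_admm_weights])
    (simp add: admm_average_def case_prod_unfold matrix_vector_mult_add_rdistrib
      scaleR_matrix_vector_assoc[symmetric] algebra_simps)

lemma convex_dgd_average:
  fixes x :: "'n::finite \<Rightarrow> real^'d"
  shows "convex ((\<lambda>w. dgd_average pq x w $ l) ` dgd_weights)"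
proof (rule convex_affine_image[OF convex_dgd_weights])
  fix w1 w2 :: "real^'d^'d" and u v :: real
  assume uv: "u + v = 1"
  \<comment> \<open>The average is affine, not linear, in the weight; eliminating \<open>v\<close>
    lets its constant terms cancel.\<close>
  then have v: "v = 1 - u" by simp
  show "dgd_average pq x (u *\<^sub>R w1 + v *\<^sub>R w2) $ l
      = u *\<^sub>R dgd_average pq x w1 $ l + v *\<^sub>R dgd_average pq x w2 $ l"
    unfolding v
    by (simp add: dgd_average_def case_prod_unfold matrix_vector_mult_add_rdistrib matrix_vector_mult_diff_rdistrib
        scaleR_matrix_vector_assoc[symmetric] algebra_simps add_divide_distrib diff_divide_distrib)
qed

lemma measurable_admm_average: "admm_average D i x \<in> borel_measurable borel"
  unfolding admm_average_def case_prod_unfold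
  by (intro borel_measurable_continuous_onI continuous_intros)

lemma measurable_dgd_average: "dgd_average pq x \<in> borel_measurable borel"
  unfolding dgd_average_def case_prod_unfold
  by (intro borel_measurable_continuous_onI continuous_intros)

text \<open>The dual variable at \<open>m\<close> reads the iterates up to \<open>m\<close> only.
  This yields \<open>upd\<close> for the first algorithm, with \<open>m = k - 1\<close>.\<close>

lemma admm_dual_upd: "m < k \<Longrightarrow> admm_dual \<zeta> i (X(k := Y)) m = admm_dual \<zeta> i X m"
  by (induction m) auto

theorem theorem2p3:
  fixes C :: "(real^'d) set"
    and F :: "'n::finite \<Rightarrow> (real^'d \<Rightarrow> real) set"
    and f :: "'n \<Rightarrow> real^'d \<Rightarrow> real"
    and D :: "'n \<Rightarrow> real" and \<zeta> B \<omega> :: real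
    and \<beta> \<eta> :: "nat \<Rightarrow> real"
    and K k :: nat and i :: 'n and l :: 'd
    and X :: "('n, 'd) trajectory"
    and Q1 :: "((real^'d^'d) \<times> (real^'d^'d)) measure"
    and Q2 :: "(real^'d^'d) measure"
    and pq :: "'n \<times> 'n"
  assumes "closed C" and "convex C"
    and "\<And>j g. g \<in> F j \<Longrightarrow> convex_on C g \<and> g differentiable_on C"
    and "\<And>j. sensitivity_bound C (F j) B" and "0 < B"
    and "\<And>j. f j \<in> F j"
    and "\<And>m. 0 < \<beta> m"
    and "k \<in> {1..K}"
    and "\<And>m j. m < k \<Longrightarrow> X m j \<in> C"
  shows
    "((\<forall>j. 0 < D j) \<and>
      random_weights (admm_weights TYPE('n) (D i)) (admm_average (D i) i (X (k - 1))) Q1 \<and>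
      \<omega> = measure lborel (admm_tau C (D i) \<zeta> k i (f i) X l) \<and>
      \<omega> > 1 / D i * B \<longrightarrow>
      expected_loss (F i) (admm_law C (D i) \<zeta> \<beta> Q1 k i) (1 / D i) (\<beta> k) B k i l (f i) X
        \<le> loss_bound (1 / D i) (\<beta> k) B \<omega>) \<and>
     ((\<forall>m. 0 < \<eta> m) \<and> \<eta> \<longlonglongrightarrow> 0 \<and>
      farthest_pair (X (k - 1)) pq \<and>
      random_weights dgd_weights (dgd_average pq (X (k - 1))) Q2 \<and>
      \<omega> = measure lborel (dgd_tau C \<eta> pq k (f i) X l) \<and>
      \<omega> > \<eta> k * B \<longrightarrow>
      expected_loss (F i) (dgd_law C \<eta> \<beta> pq Q2 k) (\<eta> k) (\<beta> k) B k i l (f i) X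
        \<le> loss_bound (\<eta> k) (\<beta> k) B \<omega>)"
proof (intro conjI impI; elim conjE)
  \<comment> \<open>Natural subtraction: this relies on \<open>1 \<le> k\<close>.\<close>
  have k: "k - 1 < k" using assms(8) by simp
  {
    assume D: "\<forall>j. 0 < D j"
      and rw: "random_weights (admm_weights TYPE('n) (D i)) (admm_average (D i) i (X (k - 1))) Q1"
      and \<omega>: "\<omega> = measure lborel (admm_tau C (D i) \<zeta> k i (f i) X l)" "1 / D i * B < \<omega>"
    show "expected_loss (F i) (admm_law C (D i) \<zeta> \<beta> Q1 k i) (1 / D i) (\<beta> k) B k i l (f i) X
        \<le> loss_bound (1 / D i) (\<beta> k) B \<omega>"
    proof (rule expected_loss_step_law_le[where c = "\<lambda>g. admm_shift C (D i) \<zeta> i g X (k - 1)" and f = "f i",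
          OF _ assms(7,5) rw measurable_admm_average convex_admm_average
            \<omega>(1)[unfolded admm_tau_def] \<omega>(2) assms(6)])
      fix g h assume "g \<in> F i" "h \<in> F i"
      then have "\<bar>(gradient C g (X (k - 1) i) - gradient C h (X (k - 1) i)) $ l\<bar> \<le> B"
        using assms(4) assms(9)[OF k] by (intro gradient_component_le)
      \<comment> \<open>The dual term does not involve the private function and cancels.\<close>
      moreover have "(admm_shift C (D i) \<zeta> i g X (k - 1) - admm_shift C (D i) \<zeta> i h X (k - 1)) $ l
          = - (1 / D i) * (gradient C g (X (k - 1) i) - gradient C h (X (k - 1) i)) $ l"
        by (simp add: admm_shift_def algebra_simps diff_divide_distrib)
      ultimately show "\<bar>(admm_shift C (D i) \<zeta> i g X (k - 1) - admm_shift C (D i) \<zeta> i h X (k - 1)) $ l\<bar>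
          \<le> 1 / D i * B"
        using D by (simp add: abs_mult divide_right_mono less_imp_le)
    qed (use D k in \<open>auto simp: admm_law_def admm_shift_def admm_dual_upd\<close>)
  next
    assume \<eta>: "\<forall>m. 0 < \<eta> m"
      and rw: "random_weights dgd_weights (dgd_average pq (X (k - 1))) Q2"
      and \<omega>: "\<omega> = measure lborel (dgd_tau C \<eta> pq k (f i) X l)" "\<eta> k * B < \<omega>"
    let ?x = "(1 / real CARD('n)) *\<^sub>R (\<Sum>j\<in>UNIV. X (k - 1) j)"
    \<comment> \<open>The sensitivity bound holds on \<open>C\<close> only; the averaged iterate
      stays there by convexity.\<close>
    have x: "?x \<in> C"
      unfolding scaleR_sum_right using assms(9)[OF k]
      by (intro convex_sum assms(2)) auto
    show "expected_loss (F i) (dgd_law C \<eta> \<beta> pq Q2 k) (\<eta> k) (\<beta> k) B k i l (f i) X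
        \<le> loss_bound (\<eta> k) (\<beta> k) B \<omega>"
    proof (rule expected_loss_step_law_le[where c = "\<lambda>g. dgd_shift C (\<eta> k) g (X (k - 1))" and f = "f i",
          OF _ assms(7,5) rw measurable_dgd_average convex_dgd_average
            \<omega>(1)[unfolded dgd_tau_def] \<omega>(2) assms(6)])
      fix g h assume "g \<in> F i" "h \<in> F i"
      then have "\<bar>(gradient C g ?x - gradient C h ?x) $ l\<bar> \<le> B"
        using assms(4) x by (intro gradient_component_le)
      moreover have "(dgd_shift C (\<eta> k) g (X (k - 1)) - dgd_shift C (\<eta> k) h (X (k - 1))) $ l
          = - \<eta> k * (gradient C g ?x - gradient C h ?x) $ l"
        by (simp add: dgd_shift_def algebra_simps)
      ultimately show "\<bar>(dgd_shift C (\<eta> k) g (X (k - 1)) - dgd_shift C (\<eta> k) h (X (k - 1))) $ l\<bar>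
          \<le> \<eta> k * B"
        using \<eta>[rule_format, of k] by (simp add: abs_mult)
    qed (use \<eta> k in \<open>auto simp: dgd_law_def\<close>)
  }
qed

end
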